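(* For any $n,t,p\in\mathbb{N}$ with $1\le t<n$ and $p\ge 1$: 1) $\begin{bmatrix} n\\ t\end{bmatrix}_p=\begin{bmatrix} n\\ n-t\end{bmatrix}_p$. 2) $\begin{bmatrix} n\\ 1\end{bmatrix}_p=\begin{bmatrix} n\\ n-1\end{bmatrix}_p=C_{p+1}(n)$, where $C_p(n)=\frac{1}{(n-1)p+1}\binom{np}{p}$ are the Fuss-Catalan numbers.
   Context: $\mathbb{N}$ is the set of nonnegative integers, and $[m]=\{1,\ldots,m\}$ (with $[0]=\emptyset$). For $n,t,p\in\mathbb{N}$ with $1\le t<n$, $p\ge1$, $\begin{bmatrix} n\\ t\end{bmatrix}_p$ denotes the number of elements of $$A(n,t,p)=\Big\{\alpha\in\mathbb{N}^{pt+1} \ \Big|\ \sum_{i=1}^{pt+1}\alpha_i=p(n-t),\ \sum_{i=1}^{kt}\alpha_i\le k(n-t)\ \text{for all } k\in[p-1]\Big\}.$$ *)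

theory Defs
  imports Complex_Main "HOL-Library.FuncSet"
begin

(* A vector in N^m is an extensional function on {1..m}, so that each vector has exactly one
   representative. The differences n - t and p - 1 are truncated subtractions on nat; the sets are
   only meant for t < n and 1 \<le> p, where they agree with the integer differences. *)
definition A :: "nat \<Rightarrow> nat \<Rightarrow> nat \<Rightarrow> (nat \<Rightarrow> nat) set" where
  "A n t p = {\<alpha> \<in> {1..p * t + 1} \<rightarrow>\<^sub>E UNIV.
     (\<Sum>i = 1..p * t + 1. \<alpha> i) = p * (n - t) \<and>
     (\<forall>k \<in> {1..p - 1}. (\<Sum>i = 1..k * t. \<alpha> i) \<le> k * (n - t))}"

(* Cardinality of an infinite set is 0 by convention; the following rules that case out. *)
lemma finite_A: "finite (A n t p)"
proof (rule finite_subset)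
  show "A n t p \<subseteq> {1..p * t + 1} \<rightarrow>\<^sub>E {..p * (n - t)}"
  proof
    fix \<alpha> assume a: "\<alpha> \<in> A n t p"
    have "\<alpha> i \<le> p * (n - t)" if "i \<in> {1..p * t + 1}" for i
      using member_le_sum[OF that, of \<alpha>] a by (simp add: A_def)
    with a show "\<alpha> \<in> {1..p * t + 1} \<rightarrow>\<^sub>E {..p * (n - t)}"
      by (auto simp: A_def PiE_iff)
  qed
  show "finite ({1..p * t + 1} \<rightarrow>\<^sub>E {..p * (n - t)})"
    by (rule finite_PiE) auto
qed

definition bracket :: "nat \<Rightarrow> nat \<Rightarrow> nat \<Rightarrow> nat" where
  "bracket n t p = card (A n t p)"

definition fuss_catalan :: "nat \<Rightarrow> nat \<Rightarrow> real" where
  "fuss_catalan p n = 1 / ((real n - 1) * real p + 1) * real ((n * p) choose p)"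

end

theory Submission
  imports Defs
begin

text \<open>
  Read \<open>\<alpha>\<close> as a lattice path with \<open>p t\<close> north steps, where \<open>\<alpha>\<^sub>i\<close> is the number of east steps
  between two consecutive north steps. The constraint says that at most \<open>k (n - t)\<close> east steps
  precede the north step number \<open>k t\<close>. Reversing the path and exchanging the two kinds of steps
  turns it into the same constraint with \<open>t\<close> and \<open>n - t\<close> exchanged.

  For \<open>t = 1\<close>, put \<open>m = n - 1\<close> and let \<open>W(k, d)\<close> be the number of sequences of length \<open>k\<close> whose
  \<open>j\<close>-th partial sum is at most \<open>d + j m\<close>. Splitting off the first term gives
  \<open>W(k + 1, d) = W(k, 0) + \<dots> + W(k, d + m)\<close>, which the Raney numbers
  \<open>r / (k (m + 1) + r) * binom (k (m + 1) + r) k\<close> with \<open>r = d + m + 1\<close> also satisfy.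
\<close>

section \<open>Reversal and transposition of lattice paths\<close>

text \<open>\<open>f i\<close> is the number of east steps before north step \<open>i\<close> in a
  lattice path with \<open>a\<close> north and \<open>b\<close> east steps; these numbers determine
  the path.\<close>

definition mono_paths :: "nat \<Rightarrow> nat \<Rightarrow> (nat \<Rightarrow> nat) set" where
  "mono_paths a b = {f \<in> {1..a} \<rightarrow>\<^sub>E {0..b}. mono_on {1..a} f}"

text \<open>After reversal and exchange of the step kinds, north step \<open>j\<close> is the former
  east step \<open>b + 1 - j\<close>. The former north step \<open>i\<close> came after it iff
  \<open>b + 1 - j \<le> f i\<close>, written here without subtraction.\<close>

definition transpose_path :: "nat \<Rightarrow> nat \<Rightarrow> (nat \<Rightarrow> nat) \<Rightarrow> nat \<Rightarrow> nat" where
  "transpose_path a b f = (\<lambda>j\<in>{1..b}. card {i \<in> {1..a}. b < f i + j})"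

text \<open>Monotonicity makes the counted set a final segment of \<open>{1..a}\<close>, so its
  cardinality alone decides which \<open>i\<close> it contains.\<close>

lemma mono_on_card_greater_iff:
  fixes f :: "nat \<Rightarrow> nat"
  assumes mono: "mono_on {1..a} f" and i: "i \<in> {1..a}"
  shows "a < card {i' \<in> {1..a}. c < f i' + d} + i \<longleftrightarrow> c < f i + d"
proof (cases "c < f i + d")
  case True
  have "{i..a} \<subseteq> {i' \<in> {1..a}. c < f i' + d}"
  proof
    fix x assume "x \<in> {i..a}"
    with i mono have "f i \<le> f x" by (intro mono_onD[OF mono]) auto
    with \<open>x \<in> {i..a}\<close> i True show "x \<in> {i' \<in> {1..a}. c < f i' + d}" by auto
  qed
  from card_mono[OF _ this] i True show ?thesis by auto
next
  case False
  have "{i' \<in> {1..a}. c < f i' + d} \<subseteq> {i<..a}"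
  proof
    fix x assume x: "x \<in> {i' \<in> {1..a}. c < f i' + d}"
    have "\<not> x \<le> i"
    proof
      assume "x \<le> i"
      with x i have "f x \<le> f i" by (intro mono_onD[OF mono]) auto
      with x False show False by auto
    qed
    with x show "x \<in> {i<..a}" by auto
  qed
  from card_mono[OF _ this] i False show ?thesis by auto
qed

lemma transpose_path_in_mono_paths: "transpose_path a b f \<in> mono_paths b a"
proof -
  have le: "card {i \<in> {1..a}. b < f i + j} \<le> a" for j
  proof -
    have "card {i \<in> {1..a}. b < f i + j} \<le> card {1..a}" by (rule card_mono) auto
    then show ?thesis by simp
  qed
  have "card {i \<in> {1..a}. b < f i + j} \<le> card {i \<in> {1..a}. b < f i + j'}" if "j \<le> j'" for j j'
    using that by (intro card_mono) auto
  with le show ?thesis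
    by (auto simp: mono_paths_def transpose_path_def mono_on_def)
qed

text \<open>Since \<open>a < transpose_path a b f j + i\<close> is equivalent to
  \<open>b < f i + j\<close>, transposing twice counts the \<open>j\<close> in \<open>{1..b}\<close>
  with \<open>b < f i + j\<close>. There are \<open>f i\<close> of them because
  \<open>f i \<le> b\<close>.\<close>

lemma transpose_path_involution:
  assumes f: "f \<in> mono_paths a b"
  shows "transpose_path b a (transpose_path a b f) = f"
proof
  fix i
  show "transpose_path b a (transpose_path a b f) i = f i"
  proof (cases "i \<in> {1..a}")
    case True
    have fi: "f i \<le> b" using f True by (auto simp: mono_paths_def PiE_iff)
    have "{j \<in> {1..b}. a < transpose_path a b f j + i} = {j \<in> {1..b}. b < f i + j}"
    proof (rule Collect_cong, rule conj_cong[OF refl])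
      fix j assume "j \<in> {1..b}"
      then have "transpose_path a b f j = card {i' \<in> {1..a}. b < f i' + j}"
        unfolding transpose_path_def by (rule restrict_apply')
      moreover have "mono_on {1..a} f" using f by (simp add: mono_paths_def)
      ultimately show "a < transpose_path a b f j + i \<longleftrightarrow> b < f i + j"
        using mono_on_card_greater_iff[OF _ True] by simp
    qed
    also have "\<dots> = {b + 1 - f i..b}" using fi by auto
    finally have "card {j \<in> {1..b}. a < transpose_path a b f j + i} = f i" using fi by simp
    with True show ?thesis by (simp add: transpose_path_def[of b a])
  next
    case False
    with f show ?thesis by (auto simp: mono_paths_def PiE_iff extensional_def transpose_path_def)
  qed
qed

definition bounded_paths :: "nat \<Rightarrow> nat \<Rightarrow> nat \<Rightarrow> (nat \<Rightarrow> nat) set" where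
  "bounded_paths p t s = {f \<in> mono_paths (p * t) (p * s). \<forall>k\<in>{1..p - 1}. f (k * t) \<le> k * s}"

text \<open>Reversal pairs \<open>k\<close> with \<open>l = p - k\<close>: the bound
  \<open>f (l * t) \<le> l * s\<close> negates \<open>p * s < f (l * t) + k * s\<close>. Hence
  \<open>p * t < g (k * s) + l * t\<close> fails for the transposed path \<open>g\<close>, which is
  its bound at \<open>k\<close>.\<close>

lemma transpose_path_in_bounded_paths:
  assumes f: "f \<in> bounded_paths p t s" and "1 \<le> t" "1 \<le> s"
  shows "transpose_path (p * t) (p * s) f \<in> bounded_paths p s t"
proof -
  have mono: "mono_on {1..p * t} f" using f by (simp add: bounded_paths_def mono_paths_def)
  have "transpose_path (p * t) (p * s) f (k * s) \<le> k * t" if k: "k \<in> {1..p - 1}" for k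
  proof -
    have "k < p" using k by auto
    then obtain l where p: "p = k + l" and l: "1 \<le> l"
      using less_imp_add_positive[of k p] by auto
    have "k * s \<in> {1..p * s}" "l * t \<in> {1..p * t}" using k l p assms by auto
    moreover have "f (l * t) \<le> l * s" using f k l p by (auto simp: bounded_paths_def)
    ultimately show ?thesis
      using mono_on_card_greater_iff[OF mono, of "l * t" "p * s" "k * s"] p
      by (simp add: transpose_path_def algebra_simps)
  qed
  with transpose_path_in_mono_paths show ?thesis by (auto simp: bounded_paths_def)
qed

lemma card_bounded_paths_swap:
  assumes "1 \<le> t" "1 \<le> s"
  shows "card (bounded_paths p t s) = card (bounded_paths p s t)"
proof (rule bij_betw_same_card)
  have inv: "transpose_path (p * t) (p * s) (transpose_path (p * s) (p * t) f) = f"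
    if "f \<in> bounded_paths p s t" for f s t
    using that transpose_path_involution by (simp add: bounded_paths_def)
  show "bij_betw (transpose_path (p * t) (p * s)) (bounded_paths p t s) (bounded_paths p s t)"
    by (rule bij_betw_byWitness[where f' = "transpose_path (p * s) (p * t)"])
      (use assms transpose_path_in_bounded_paths inv in blast)+
qed

section \<open>Partial sums\<close>

text \<open>The second conjunct strengthens the induction: it ensures that the truncated differences
  add up exactly.\<close>

lemma sum_telescope_nat:
  fixes g :: "nat \<Rightarrow> nat"
  assumes "\<And>i. i < j \<Longrightarrow> g i \<le> g (Suc i)"
  shows "(\<Sum>i = 1..j. g i - g (i - 1)) = g j - g 0 \<and> g 0 \<le> g j"
  using assms
proof (induction j)
  case (Suc j)
  have "g j \<le> g (Suc j)" using Suc.prems by simp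
  moreover have "(\<Sum>i = 1..j. g i - g (i - 1)) = g j - g 0 \<and> g 0 \<le> g j"
    using Suc by simp
  ultimately show ?case by simp
qed simp

lemma bij_betw_partial_sums:
  "bij_betw (\<lambda>\<alpha>. \<lambda>j\<in>{1..a}. \<Sum>i = 1..j. \<alpha> i)
     {\<alpha> \<in> {1..a + 1} \<rightarrow>\<^sub>E UNIV. (\<Sum>i = 1..a + 1. \<alpha> i) = b} (mono_paths a b)"
    (is "bij_betw ?S ?X _")
proof -
  \<comment> \<open>\<open>g f\<close> extends \<open>f\<close> by \<open>0\<close> at
    \<open>0\<close> and by the prescribed total \<open>b\<close> at \<open>a + 1\<close>, so that
    its differences \<open>D f\<close> recover all \<open>a + 1\<close> entries.\<close>
  define g :: "(nat \<Rightarrow> nat) \<Rightarrow> nat \<Rightarrow> nat"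
    where "g f i = (if i = 0 then 0 else if i \<le> a then f i else b)" for f i
  define D :: "(nat \<Rightarrow> nat) \<Rightarrow> nat \<Rightarrow> nat"
    where "D f = (\<lambda>i\<in>{1..a + 1}. g f i - g f (i - 1))" for f
  have sum_D: "(\<Sum>i = 1..j. D f i) = g f j" if f: "f \<in> mono_paths a b" and j: "j \<le> a + 1" for f j
  proof -
    have "f i \<le> f (Suc i)" if "1 \<le> i" "Suc i \<le> a" for i
      using f that by (auto simp: mono_paths_def mono_on_def)
    then have "g f i \<le> g f (Suc i)" for i
      using f by (auto simp: g_def mono_paths_def PiE_iff)
    then have "(\<Sum>i = 1..j. g f i - g f (i - 1)) = g f j"
      using sum_telescope_nat[of j "g f"] by (simp add: g_def)
    moreover have "(\<Sum>i = 1..j. D f i) = (\<Sum>i = 1..j. g f i - g f (i - 1))"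
      using j by (intro sum.cong) (auto simp: D_def)
    ultimately show ?thesis by simp
  qed
  have g_S: "g (?S \<alpha>) j = (\<Sum>i = 1..j. \<alpha> i)" if "\<alpha> \<in> ?X" "j \<le> a + 1" for \<alpha> j
    using that by (cases "j = a + 1") (auto simp: g_def)
  show ?thesis
  proof (rule bij_betw_byWitness[where f' = D])
    show "\<forall>\<alpha>\<in>?X. D (?S \<alpha>) = \<alpha>"
    proof (intro ballI ext)
      fix \<alpha> i assume \<alpha>: "\<alpha> \<in> ?X"
      show "D (?S \<alpha>) i = \<alpha> i"
      proof (cases "i \<in> {1..a + 1}")
        case True
        then obtain i' where i': "i = Suc i'" by (cases i) auto
        have "D (?S \<alpha>) i = g (?S \<alpha>) i - g (?S \<alpha>) (i - 1)"
          using True unfolding D_def by (rule restrict_apply')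
        also have "\<dots> = (\<Sum>j = 1..i. \<alpha> j) - (\<Sum>j = 1..i - 1. \<alpha> j)"
        proof -
          have "i \<le> a + 1" "i - 1 \<le> a + 1" using True by auto
          then show ?thesis by (simp only: g_S[OF \<alpha>])
        qed
        also have "\<dots> = \<alpha> i" by (simp add: i')
        finally show ?thesis .
      next
        case False
        with \<alpha> show ?thesis by (auto simp: D_def PiE_iff extensional_def)
      qed
    qed
    show "\<forall>f\<in>mono_paths a b. ?S (D f) = f"
    proof (intro ballI ext)
      fix f i assume f: "f \<in> mono_paths a b"
      show "?S (D f) i = f i"
      proof (cases "i \<in> {1..a}")
        case True
        then show ?thesis using sum_D[OF f, of i] by (simp add: g_def)
      next
        case False
        with f show ?thesis by (auto simp: mono_paths_def PiE_iff extensional_def)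
      qed
    qed
    show "?S ` ?X \<subseteq> mono_paths a b"
    proof
      fix f assume "f \<in> ?S ` ?X"
      then obtain \<alpha> where \<alpha>: "\<alpha> \<in> ?X" and f: "f = ?S \<alpha>" by blast
      have le: "(\<Sum>i = 1..j. \<alpha> i) \<le> (\<Sum>i = 1..j'. \<alpha> i)" if "j \<le> j'" for j j'
        using that by (intro sum_mono2) auto
      have "(\<Sum>i = 1..j. \<alpha> i) \<le> b" if "j \<le> a" for j
        using le[of j "a + 1"] that \<alpha> by simp
      with le show "f \<in> mono_paths a b"
        unfolding f mono_paths_def by (auto simp: mono_on_def)
    qed
    show "D ` mono_paths a b \<subseteq> ?X"
    proof
      fix \<alpha> assume "\<alpha> \<in> D ` mono_paths a b"
      then obtain f where f: "f \<in> mono_paths a b" and \<alpha>: "\<alpha> = D f" by blast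
      have "(\<Sum>i = 1..a + 1. \<alpha> i) = b" using sum_D[OF f, of "a + 1"] by (simp add: \<alpha> g_def)
      moreover have "\<alpha> \<in> {1..a + 1} \<rightarrow>\<^sub>E UNIV" by (simp add: \<alpha> D_def)
      ultimately show "\<alpha> \<in> ?X" by blast
    qed
  qed
qed

text \<open>The constraints of \<open>A\<close> involve partial sums only, so the bijection of
  partial sums restricts to them.\<close>

lemma bracket_eq_card_bounded_paths:
  assumes "1 \<le> t"
  shows "bracket n t p = card (bounded_paths p t (n - t))"
proof -
  let ?S = "\<lambda>\<alpha>. \<lambda>j\<in>{1..p * t}. \<Sum>i = 1..j. \<alpha> i :: nat"
  let ?X = "{\<alpha> \<in> {1..p * t + 1} \<rightarrow>\<^sub>E UNIV. (\<Sum>i = 1..p * t + 1. \<alpha> i) = p * (n - t)}"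
  have bij: "bij_betw ?S ?X (mono_paths (p * t) (p * (n - t)))"
    by (rule bij_betw_partial_sums)
  \<comment> \<open>\<open>1 \<le> t\<close> and \<open>k < p\<close> keep \<open>k * t\<close> in
    \<open>{1..p * t}\<close>, outside of which the restricted function is
    \<open>undefined\<close>.\<close>
  have S: "?S \<alpha> (k * t) = (\<Sum>i = 1..k * t. \<alpha> i)" if "k \<in> {1..p - 1}" for \<alpha> k
    using that assms by (intro restrict_apply') auto
  have "A n t p = {\<alpha> \<in> ?X. \<forall>k\<in>{1..p - 1}. ?S \<alpha> (k * t) \<le> k * (n - t)}"
    unfolding A_def using S by (auto simp del: restrict_apply)
  then have img: "?S ` A n t p = bounded_paths p t (n - t)"
    using bij unfolding bounded_paths_def bij_betw_def by (auto simp del: restrict_apply)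
  have "inj_on ?S (A n t p)"
    by (rule inj_on_subset[OF bij_betw_imp_inj_on[OF bij]]) (auto simp: A_def)
  from card_image[OF this] img show ?thesis by (simp add: bracket_def)
qed

lemma bracket_symmetric:
  assumes "1 \<le> t" "t < n"
  shows "bracket n t p = bracket n (n - t) p"
  using assms card_bounded_paths_swap[of t "n - t" p]
  by (simp add: bracket_eq_card_bounded_paths)

section \<open>Raney numbers\<close>

text \<open>With \<open>r = 0\<close> and \<open>k = 0\<close> this is \<open>0 / 0 = 0\<close> instead of \<open>1\<close>.\<close>
definition raney :: "nat \<Rightarrow> nat \<Rightarrow> nat \<Rightarrow> real" where
  "raney P k r = real r / real (k * P + r) * real ((k * P + r) choose k)"

text \<open>Apart from \<open>r = k = 0\<close>, \<open>raney P k r\<close> is the coefficient of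
  \<open>z^k\<close> in \<open>B^r\<close>, where \<open>B = 1 + z B^P\<close>; the recurrence
  reflects \<open>B^(r+1) = B^r + z B^(r+P)\<close>. The proof writes all three terms as multiples
  of \<open>M choose k\<close>.\<close>

lemma raney_Suc_Suc:
  assumes "1 \<le> P"
  shows "raney P (Suc k) (Suc r) = raney P (Suc k) r + raney P k (r + P)"
proof -
  define M where "M = Suc k * P + r"
  have "M \<ge> 1" using assms by (simp add: M_def)
  have c1: "real (Suc k) * real (Suc M choose Suc k) = real (Suc M) * real (M choose k)"
    using Suc_times_binomial_eq[of M k] by (metis of_nat_mult mult.commute)
  have c2: "real (M choose Suc k) * real (Suc k) = (real M - real k) * real (M choose k)"
  proof (cases "k \<le> M")
    case True
    with binomial_absorb_comp[of M k] Suc_times_binomial_eq[of M k]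
    have "(M choose Suc k) * Suc k = (M - k) * (M choose k)"
      by (simp add: algebra_simps)
    with True show ?thesis by (metis of_nat_diff of_nat_mult)
  qed (simp add: binomial_eq_0)
  have "raney P (Suc k) (Suc r) = real (Suc r) * real (M choose k) / real (Suc k)"
  proof -
    have M: "Suc k * P + Suc r = Suc M" by (simp add: M_def)
    have "real (Suc M choose Suc k) = real (Suc M) * real (M choose k) / real (Suc k)"
      using c1 by (simp add: eq_divide_eq mult.commute del: binomial_Suc_Suc of_nat_Suc)
    then show ?thesis unfolding raney_def M by (simp del: binomial_Suc_Suc of_nat_Suc)
  qed
  moreover have "raney P (Suc k) r
      = real r * (real M - real k) * real (M choose k) / (real M * real (Suc k))"
  proof -
    have "real (M choose Suc k) = (real M - real k) * real (M choose k) / real (Suc k)"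
      using c2 by (simp add: eq_divide_eq del: of_nat_Suc)
    then show ?thesis unfolding raney_def M_def[symmetric] by (simp del: of_nat_Suc)
  qed
  moreover have "raney P k (r + P) = real (r + P) * real (M choose k) / real M"
    by (simp add: raney_def M_def algebra_simps)
  moreover have "real (Suc r) * real M = real r * (real M - real k) + real (r + P) * real (Suc k)"
    by (simp add: M_def algebra_simps)
  \<comment> \<open>Field algebra for \<open>B = M choose k\<close>, with \<open>x = r + 1\<close>,
    \<open>y = k + 1\<close>, \<open>w = M\<close>, \<open>r' = r\<close>, \<open>z = M - k\<close>
    and \<open>v = r + P\<close>.\<close>
  moreover have "x * B / y = r' * z * B / (w * y) + v * B / w"
    if "x * w = r' * z + v * y" "w \<noteq> 0" "y \<noteq> 0" for x y z w v r' B :: real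
  proof -
    have "x * B / y = (x * w) * B / (w * y)" using that(2,3) by simp
    also have "\<dots> = r' * z * B / (w * y) + v * B / w"
      using that(2,3) unfolding that(1) by (simp add: field_simps)
    finally show ?thesis .
  qed
  ultimately show ?thesis using \<open>M \<ge> 1\<close> by simp
qed

text \<open>\<open>raney_Suc_Suc\<close> telescopes in \<open>r\<close>, and the boundary term
  \<open>raney P (Suc k) 0\<close> vanishes through its factor \<open>r\<close>.\<close>

lemma sum_raney:
  assumes "1 \<le> P"
  shows "(\<Sum>e<r. raney P k (e + P)) = raney P (Suc k) r"
  by (induction r) (simp_all add: raney_Suc_Suc[OF assms], simp add: raney_def)

section \<open>Counting lists with bounded partial sums\<close>

definition slow_lists :: "nat \<Rightarrow> nat \<Rightarrow> nat \<Rightarrow> nat list set" where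
  "slow_lists m k d = {xs. length xs = k \<and> (\<forall>j\<le>k. sum_list (take j xs) \<le> d + j * m)}"

text \<open>After a first term \<open>x\<close>, the slack \<open>e = d + m - x\<close> is left for
  the tail; the union is indexed by this slack instead of by \<open>x\<close>.\<close>

lemma slow_lists_Suc:
  "slow_lists m (Suc k) d = (\<Union>e\<le>d + m. (#) (d + m - e) ` slow_lists m k e)"
proof (intro set_eqI iffI)
  fix xs assume "xs \<in> slow_lists m (Suc k) d"
  then obtain x ys where xs: "xs = x # ys" and len: "length ys = k"
    and le: "\<And>j. j \<le> Suc k \<Longrightarrow> sum_list (take j xs) \<le> d + j * m"
    by (auto simp: slow_lists_def length_Suc_conv)
  have x: "x \<le> d + m" using le[of 1] by (simp add: xs)
  have "sum_list (take j ys) \<le> (d + m - x) + j * m" if "j \<le> k" for j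
    using le[of "Suc j"] that x by (simp add: xs)
  with len have "ys \<in> slow_lists m k (d + m - x)" by (simp add: slow_lists_def)
  with x show "xs \<in> (\<Union>e\<le>d + m. (#) (d + m - e) ` slow_lists m k e)"
    unfolding xs by (intro UN_I[of "d + m - x"]) auto
next
  fix xs assume "xs \<in> (\<Union>e\<le>d + m. (#) (d + m - e) ` slow_lists m k e)"
  then obtain e ys where e: "e \<le> d + m" and xs: "xs = (d + m - e) # ys"
    and ys: "ys \<in> slow_lists m k e" by auto
  have "sum_list (take j xs) \<le> d + j * m" if "j \<le> Suc k" for j
  proof (cases j)
    case (Suc i)
    with ys that have "sum_list (take i ys) \<le> e + i * m" by (simp add: slow_lists_def)
    with e show ?thesis by (simp add: xs Suc)
  qed simp
  with ys show "xs \<in> slow_lists m (Suc k) d" by (simp add: slow_lists_def xs)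
qed

lemma card_slow_lists:
  "finite (slow_lists m k d) \<and> real (card (slow_lists m k d)) = raney (m + 1) k (d + m + 1)"
proof (induction k arbitrary: d)
  case 0
  \<comment> \<open>Here \<open>r = d + m + 1\<close> is positive, so \<open>raney\<close> is
    \<open>1\<close> and not the default value of \<open>0 / 0\<close>.\<close>
  have "slow_lists m 0 d = {[]}" by (auto simp: slow_lists_def)
  then show ?case by (simp add: raney_def)
next
  case (Suc k)
  have fin: "finite (slow_lists m (Suc k) d)" using Suc.IH by (simp add: slow_lists_Suc)
  \<comment> \<open>Distinct \<open>e \<le> d + m\<close> give distinct heads
    \<open>d + m - e\<close>, so the union is disjoint.\<close>
  have "card (slow_lists m (Suc k) d) = (\<Sum>e\<le>d + m. card ((#) (d + m - e) ` slow_lists m k e))"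
    unfolding slow_lists_Suc using Suc.IH by (intro card_UN_disjoint) auto
  also have "\<dots> = (\<Sum>e\<le>d + m. card (slow_lists m k e))"
    by (intro sum.cong card_image) auto
  finally have "real (card (slow_lists m (Suc k) d))
      = (\<Sum>e<d + m + 1. raney (m + 1) k (e + (m + 1)))"
    using Suc.IH by (simp add: lessThan_Suc_atMost add.assoc)
  also have "\<dots> = raney (m + 1) (Suc k) (d + m + 1)" by (rule sum_raney) simp
  finally show ?case using fin by simp
qed

lemma sum_list_take_map_upt:
  fixes f :: "nat \<Rightarrow> nat"
  assumes "j \<le> p"
  shows "sum_list (take j (map f [1..<p + 1])) = (\<Sum>i = 1..j. f i)"
proof -
  have "take j (map f [1..<p + 1]) = map f [1..<j + 1]"
    using assms by (simp add: take_map del: upt_Suc)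
  also have "sum_list \<dots> = sum f (set [1..<j + 1])"
    by (rule interv_sum_list_conv_sum_set_nat)
  also have "set [1..<j + 1] = {1..j}" by auto
  finally show ?thesis .
qed

lemma bij_betw_A_slow_lists:
  "bij_betw (\<lambda>\<alpha>. map \<alpha> [1..<p + 1]) (A n 1 p) (slow_lists (n - 1) p 0)"
proof -
  define m where "m = n - 1"
  define G :: "nat list \<Rightarrow> nat \<Rightarrow> nat"
    where "G xs = (\<lambda>i\<in>{1..p + 1}. if i \<le> p then xs ! (i - 1) else p * m - sum_list xs)" for xs
  have map_G: "map (G xs) [1..<p + 1] = xs" if "length xs = p" for xs
    using that by (intro nth_equalityI) (auto simp: G_def simp del: upt_Suc)
  have A_iff: "\<alpha> \<in> A n 1 p \<longleftrightarrow> \<alpha> \<in> {1..p + 1} \<rightarrow>\<^sub>E UNIV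
      \<and> (\<Sum>i = 1..p. \<alpha> i) + \<alpha> (p + 1) = p * m \<and> (\<forall>k\<le>p. (\<Sum>i = 1..k. \<alpha> i) \<le> k * m)" for \<alpha>
  proof -
    \<comment> \<open>Lists are also constrained at \<open>k = 0\<close>, where the sum is empty,
      and at \<open>k = p\<close>, where the bound follows from the total.\<close>
    have "(\<forall>k\<in>{1..p - 1}. (\<Sum>i = 1..k. \<alpha> i) \<le> k * m) \<longleftrightarrow> (\<forall>k\<le>p. (\<Sum>i = 1..k. \<alpha> i) \<le> k * m)"
      if "(\<Sum>i = 1..p. \<alpha> i) + \<alpha> (p + 1) = p * m"
    proof (intro iffI allI impI ballI)
      fix k assume *: "\<forall>k\<in>{1..p - 1}. (\<Sum>i = 1..k. \<alpha> i) \<le> k * m" and "k \<le> p"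
      then consider "k = 0" | "k \<in> {1..p - 1}" | "k = p" by force
      then show "(\<Sum>i = 1..k. \<alpha> i) \<le> k * m" using * that by cases auto
    qed auto
    then show ?thesis unfolding A_def m_def by auto
  qed
  have slow_iff: "map \<alpha> [1..<p + 1] \<in> slow_lists m p 0
      \<longleftrightarrow> (\<forall>k\<le>p. (\<Sum>i = 1..k. \<alpha> i) \<le> k * m)" for \<alpha>
    using sum_list_take_map_upt[of _ p \<alpha>] by (simp add: slow_lists_def del: upt_Suc)
  show ?thesis
    unfolding m_def[symmetric]
  proof (rule bij_betw_byWitness[where f' = G])
    show "\<forall>\<alpha>\<in>A n 1 p. G (map \<alpha> [1..<p + 1]) = \<alpha>"
    proof (intro ballI ext)
      fix \<alpha> i assume \<alpha>: "\<alpha> \<in> A n 1 p"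
      have "sum_list (map \<alpha> [1..<p + 1]) = (\<Sum>i = 1..p. \<alpha> i)"
        using sum_list_take_map_upt[of p p \<alpha>] by (simp del: upt_Suc)
      then have last: "p * m - sum_list (map \<alpha> [1..<p + 1]) = \<alpha> (p + 1)"
        using \<alpha> A_iff[of \<alpha>] by (metis add_diff_cancel_left')
      consider "i \<in> {1..p}" | "i = p + 1" | "i \<notin> {1..p + 1}" by force
      then show "G (map \<alpha> [1..<p + 1]) i = \<alpha> i"
      proof cases
        case 3
        with \<alpha> show ?thesis by (auto simp: G_def A_def PiE_iff extensional_def)
      qed (use last in \<open>auto simp: G_def simp del: upt_Suc\<close>)
    qed
    show "\<forall>xs\<in>slow_lists m p 0. map (G xs) [1..<p + 1] = xs"
      using map_G by (simp add: slow_lists_def)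
    show "(\<lambda>\<alpha>. map \<alpha> [1..<p + 1]) ` A n 1 p \<subseteq> slow_lists m p 0"
      using A_iff slow_iff by blast
    show "G ` slow_lists m p 0 \<subseteq> A n 1 p"
    proof
      fix \<alpha> assume "\<alpha> \<in> G ` slow_lists m p 0"
      then obtain xs where xs: "xs \<in> slow_lists m p 0" and \<alpha>: "\<alpha> = G xs" by blast
      have map: "map \<alpha> [1..<p + 1] = xs" using xs map_G by (simp add: \<alpha> slow_lists_def)
      with xs slow_iff have le: "\<forall>k\<le>p. (\<Sum>i = 1..k. \<alpha> i) \<le> k * m" by metis
      have "sum_list xs = (\<Sum>i = 1..p. \<alpha> i)"
        using sum_list_take_map_upt[of p p \<alpha>] xs unfolding map by (simp add: slow_lists_def)
      moreover have "\<alpha> (p + 1) = p * m - sum_list xs" by (simp add: \<alpha> G_def)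
      \<comment> \<open>The bound at \<open>k = p\<close> makes the truncated difference in
        \<open>G\<close> exact.\<close>
      ultimately have "(\<Sum>i = 1..p. \<alpha> i) + \<alpha> (p + 1) = p * m" using le by auto
      moreover have "\<alpha> \<in> {1..p + 1} \<rightarrow>\<^sub>E UNIV" by (simp add: \<alpha> G_def)
      ultimately show "\<alpha> \<in> A n 1 p" using le A_iff by blast
    qed
  qed
qed

section \<open>Identification with the Fuss-Catalan numbers\<close>

lemma raney_eq_fuss_catalan:
  assumes "1 \<le> n"
  shows "raney n p n = fuss_catalan (p + 1) n"
proof -
  \<comment> \<open>The Raney side is \<open>(N choose p) / (p + 1)\<close>, the Fuss-Catalan side
    \<open>(N choose (p + 1)) / (N - p)\<close>; absorption identities equate them.\<close>
  define N where "N = n * (p + 1)"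
  have "p < N" using assms mult_le_mono1[of 1 n "p + 1"] by (simp add: N_def)
  have "(N choose Suc p) * Suc p = (N - p) * (N choose p)"
    using binomial_absorb_comp[of N p] Suc_times_binomial_eq[of N p]
    by (simp add: algebra_simps)
  then have c: "real (N choose (p + 1)) * (real p + 1) = (real N - real p) * real (N choose p)"
    using less_imp_le[OF \<open>p < N\<close>] by (metis Suc_eq_plus1 of_nat_Suc of_nat_diff of_nat_mult add.commute)
  have d: "(real n - 1) * real (p + 1) + 1 = real N - real p"
    by (simp add: N_def algebra_simps)
  have "raney n p n = real (N choose p) / (real p + 1)"
  proof -
    have "p * n + n = N" by (simp add: N_def algebra_simps)
    moreover have "real N = real n * (real p + 1)" by (simp add: N_def algebra_simps)
    then have "real n / real N = 1 / (real p + 1)" using assms by simp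
    ultimately show ?thesis unfolding raney_def by simp
  qed
  also have "\<dots> = real (N choose (p + 1)) / (real N - real p)"
    using c \<open>p < N\<close> by (simp add: field_simps)
  finally show ?thesis
    unfolding fuss_catalan_def d N_def by simp
qed

lemma bracket_1:
  assumes "1 \<le> n"
  shows "real (bracket n 1 p) = fuss_catalan (p + 1) n"
proof -
  have "bracket n 1 p = card (slow_lists (n - 1) p 0)"
    unfolding bracket_def by (rule bij_betw_same_card[OF bij_betw_A_slow_lists])
  \<comment> \<open>For \<open>m = n - 1\<close> and \<open>d = 0\<close>, both Raney parameters
    \<open>m + 1\<close> and \<open>d + m + 1\<close> equal \<open>n\<close>.\<close>
  with card_slow_lists[of "n - 1" p 0] assms raney_eq_fuss_catalan show ?thesis by simp
qed

theorem proposition4: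
  fixes n t p :: nat
  assumes "1 \<le> t" and "t < n" and "1 \<le> p"
  shows "bracket n t p = bracket n (n - t) p \<and>
    (bracket n 1 p = bracket n (n - 1) p \<and>
     real (bracket n (n - 1) p) = fuss_catalan (p + 1) n)"
  using assms bracket_symmetric[of t n p] bracket_symmetric[of 1 n p] bracket_1[of n p] by simp

end
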